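(* Let $f\in\mathcal{S}$ be given by $f(z)=z+a_2z^2+a_3z^3+\cdots$, and let $\gamma_3$ be its third logarithmic coefficient. Then $$|\gamma_3|\le 0.5566178\ldots.$$
   Context: $\mathbb{D}=\{z:|z|<1\}$ is the open unit disk in the complex plane. $\mathcal{A}$ is the class of functions $f$ analytic in $\mathbb{D}$ of the form $f(z)=z+a_2z^2+a_3z^3+\cdots$. $\mathcal{S}$ is the subclass of $\mathcal{A}$ consisting of the functions that are univalent (injective) in $\mathbb{D}$. For $f\in\mathcal{S}$ the logarithmic coefficients $\gamma_n$ are defined by $$F_f(z):=\log\frac{f(z)}{z}=2\sum_{n=1}^{\infty}\gamma_nz^n,\qquad z\in\mathbb{D},$$ where $f(z)/z$ is understood to equal $1$ at $z=0$ and the analytic branch of the logarithm with value $0$ at $z=0$ is taken. *)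

theory Defs
  imports "HOL-Complex_Analysis.Complex_Analysis"
begin

abbreviation unit_disk :: "complex set"  (\<open>\<D>\<close>) where
  "\<D> \<equiv> ball 0 1"

definition class_A :: "(complex \<Rightarrow> complex) set"  (\<open>\<A>\<close>) where
  "\<A> = {f. f holomorphic_on \<D> \<and>
            (\<exists>a. \<forall>z\<in>\<D>. (\<lambda>n. a (n + 2) * z ^ (n + 2)) sums (f z - z))}"

definition class_S :: "(complex \<Rightarrow> complex) set"  (\<open>\<S>\<close>) where
  "\<S> = {f \<in> \<A>. inj_on f \<D>}"

definition is_log_branch :: "(complex \<Rightarrow> complex) \<Rightarrow> (complex \<Rightarrow> complex) \<Rightarrow> bool" where
  "is_log_branch f F \<longleftrightarrow>
     F holomorphic_on \<D> \<and> F 0 = 0 \<and>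
     (\<forall>z\<in>\<D>. exp (F z) = (if z = 0 then 1 else f z / z))"

text \<open>
  A branch is determined on the unit disk only (see \<open>is_log_branch_unique\<close>); its values
  elsewhere are arbitrary, which does not affect the Taylor coefficients at the origin.
\<close>

definition log_branch :: "(complex \<Rightarrow> complex) \<Rightarrow> complex \<Rightarrow> complex" where
  "log_branch f = (SOME F. is_log_branch f F)"

definition log_coeff :: "(complex \<Rightarrow> complex) \<Rightarrow> nat \<Rightarrow> complex"  (\<open>\<gamma>\<close>) where
  "log_coeff f n = fps_nth (fps_expansion (log_branch f) 0) n / 2"

lemma sums_imp_taylor_coeff:
  assumes "\<And>z. z \<in> \<D> \<Longrightarrow> (\<lambda>n. c n * z ^ n) sums g z"
  shows "(deriv ^^ n) g 0 / fact n = c n"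
proof -
  have "eventually (\<lambda>z::complex. z \<in> \<D>) (nhds 0)"
    by (intro eventually_nhds_in_open) auto
  then have "eventually (\<lambda>z. (\<lambda>n. fps_nth (Abs_fps c) n * z ^ n) sums g z) (nhds 0)"
    by eventually_elim (use assms in simp)
  then have "g has_fps_expansion Abs_fps c"
    by (rule has_fps_expansionI)
  then show ?thesis
    using fps_nth_fps_expansion[of g "Abs_fps c" n] by simp
qed

lemma class_A_iff: "f \<in> \<A> \<longleftrightarrow> f holomorphic_on \<D> \<and> f 0 = 0 \<and> deriv f 0 = 1"
proof
  assume "f \<in> \<A>"
  then obtain a where hol: "f holomorphic_on \<D>"
    and a: "\<And>z. z \<in> \<D> \<Longrightarrow> (\<lambda>n. a (n + 2) * z ^ (n + 2)) sums (f z - z)"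
    unfolding class_A_def by blast
  define c where "c n = (if n = 0 then 0 else if n = 1 then 1 else a n)" for n
  have c: "(\<lambda>n. c n * z ^ n) sums f z" if "z \<in> \<D>" for z
  proof -
    have "(\<lambda>n. c (n + 2) * z ^ (n + 2)) sums (f z - (\<Sum>i<2. c i * z ^ i))"
      using a[OF that] by (simp add: c_def numeral_2_eq_2)
    then show ?thesis
      by (subst (asm) sums_iff_shift) simp
  qed
  have "(deriv ^^ 0) f 0 / fact 0 = c 0" "(deriv ^^ 1) f 0 / fact 1 = c 1"
    by (rule sums_imp_taylor_coeff[OF c]; assumption)+
  with hol show "f holomorphic_on \<D> \<and> f 0 = 0 \<and> deriv f 0 = 1"
    by (simp add: c_def)
next
  assume *: "f holomorphic_on \<D> \<and> f 0 = 0 \<and> deriv f 0 = 1"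
  define a where "a n = (deriv ^^ n) f 0 / fact n" for n
  have "(\<lambda>n. a (n + 2) * z ^ (n + 2)) sums (f z - z)" if "z \<in> \<D>" for z
  proof -
    have "(\<lambda>n. a n * z ^ n) sums f z"
      using holomorphic_power_series[of f 0 1 z] * that by (simp add: a_def)
    then have "(\<lambda>n. a (n + 2) * z ^ (n + 2)) sums (f z - (\<Sum>i<2. a i * z ^ i))"
      by (subst sums_iff_shift) simp
    then show ?thesis
      using * by (simp add: a_def numeral_2_eq_2)
  qed
  with * show "f \<in> \<A>"
    unfolding class_A_def by blast
qed

lemma is_log_branch_exists:
  assumes "f \<in> \<S>"
  shows "\<exists>F. is_log_branch f F"
proof -
  have hol: "f holomorphic_on \<D>" and f0: "f 0 = 0" and f1: "deriv f 0 = 1" and inj: "inj_on f \<D>"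
    using assms by (auto simp: class_S_def class_A_iff)
  define q where "q z = (if z = 0 then 1 else f z / z)" for z
  have "(\<lambda>z. if z = 0 then deriv f 0 else (f z - f 0) / (z - 0)) holomorphic_on \<D>"
    using hol by (intro pole_lemma_open) auto
  then have q: "q holomorphic_on \<D>"
    by (rule holomorphic_transform) (auto simp: q_def f0 f1)
  have "q z \<noteq> 0" if "z \<in> \<D>" for z
    using inj_onD[OF inj, of z 0] that by (auto simp: q_def f0)
  with q obtain g where g: "g holomorphic_on \<D>" "\<And>z. z \<in> \<D> \<Longrightarrow> exp (g z) = q z"
    using holomorphic_logarithm_exists[of "\<D>" q 0] by auto
  have "exp (g 0) = 1"
    using g(2)[of 0] by (simp add: q_def)
  then have "is_log_branch f (\<lambda>z. g z - g 0)"
    using g unfolding is_log_branch_def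
    by (auto simp: q_def exp_diff intro!: holomorphic_intros)
  then show ?thesis by blast
qed

lemma is_log_branch_unique:
  assumes F: "is_log_branch f F" and G: "is_log_branch f G" and z: "z \<in> \<D>"
  shows "F z = G z"
proof -
  define h where "h z = F z - G z" for z
  have h: "h holomorphic_on \<D>"
    using F G unfolding is_log_branch_def h_def by (intro holomorphic_intros) auto
  have e: "exp (h w) = 1" if "w \<in> \<D>" for w
  proof -
    have "exp (F w) = exp (G w)"
      using F G that by (simp add: is_log_branch_def)
    then show ?thesis by (simp add: h_def exp_diff)
  qed
  have "(h has_field_derivative 0) (at w within \<D>)" if w: "w \<in> \<D>" for w
  proof -
    have d: "(h has_field_derivative deriv h w) (at w)"
      using h w by (intro holomorphic_derivI[of h \<D>]) auto
    have "((\<lambda>w. exp (h w)) has_field_derivative exp (h w) * deriv h w) (at w)"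
      using d by (auto intro!: derivative_eq_intros)
    moreover have "((\<lambda>w. exp (h w)) has_field_derivative 0) (at w)"
      by (rule has_field_derivative_transform_within_open[of "\<lambda>_. 1" 0 w \<D>])
         (use w e in auto)
    ultimately have "exp (h w) * deriv h w = 0"
      by (rule DERIV_unique)
    then have "deriv h w = 0" by simp
    with d show ?thesis
      using has_field_derivative_at_within by fastforce
  qed
  then obtain c where "\<And>w. w \<in> \<D> \<Longrightarrow> h w = c"
    using has_field_derivative_zero_constant[of \<D> h] by auto
  moreover have "h 0 = 0"
    using F G by (simp add: h_def is_log_branch_def)
  ultimately have "h z = 0" using z by (metis centre_in_ball zero_less_one)
  then show ?thesis by (simp add: h_def)
qed

lemma log_branch:
  assumes "f \<in> \<S>"
  shows "is_log_branch f (log_branch f)"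
  unfolding log_branch_def by (rule someI_ex[OF is_log_branch_exists[OF assms]])

lemma log_coeff_sums:
  assumes "f \<in> \<S>" "z \<in> \<D>"
  shows "(\<lambda>n. 2 * (\<gamma> f (n + 1) * z ^ (n + 1))) sums log_branch f z"
proof -
  let ?F = "log_branch f"
  have F: "?F holomorphic_on \<D>" "?F 0 = 0"
    using log_branch[OF assms(1)] by (auto simp: is_log_branch_def)
  have "(\<lambda>n. 2 * (\<gamma> f n * z ^ n)) sums ?F z"
    using holomorphic_power_series[OF F(1) assms(2)] by (simp add: log_coeff_def fps_expansion_def)
  moreover have "\<gamma> f 0 = 0"
    using F(2) by (simp add: log_coeff_def fps_expansion_def)
  ultimately show ?thesis
    using sums_iff_shift[of "\<lambda>n. 2 * (\<gamma> f n * z ^ n)" 1 "?F z"] by simp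
qed

lemma log_coeff_unique:
  assumes f: "f \<in> \<S>" and F: "is_log_branch f F"
    and g: "\<And>z. z \<in> \<D> \<Longrightarrow> (\<lambda>n. 2 * (g (n + 1) * z ^ (n + 1))) sums F z"
    and n: "n \<ge> 1"
  shows "g n = \<gamma> f n"
proof -
  define c where "c n = (if n = 0 then 0 else 2 * g n)" for n
  have c: "(\<lambda>n. c n * z ^ n) sums log_branch f z" if "z \<in> \<D>" for z
  proof -
    have "log_branch f z = F z"
      using is_log_branch_unique[OF log_branch[OF f] F that] .
    then have "(\<lambda>n. c (n + 1) * z ^ (n + 1)) sums log_branch f z"
      using g[OF that] by (simp add: c_def mult.assoc)
    then show ?thesis
      using sums_iff_shift[of "\<lambda>n. c n * z ^ n" 1 "log_branch f z"] by (simp add: c_def)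
  qed
  have "(deriv ^^ n) (log_branch f) 0 / fact n = c n"
    by (rule sums_imp_taylor_coeff[OF c])
  then show ?thesis
    using n by (simp add: log_coeff_def fps_expansion_def c_def)
qed

text \<open>
  The bound \<open>0.5566178\<dots>\<close> is the algebraic number below. It is the maximum of
  \<open>x\<^sup>3 / 3 + x * y + z\<close> over \<open>x, y, z \<ge> 0\<close> with \<open>x\<^sup>2 + 3 * y\<^sup>2 + 5 * z\<^sup>2 \<le> 1\<close>,
  where \<open>x\<close>, \<open>y\<close>, \<open>z\<close> stand for the moduli of the first three Grunsky coefficients
  \<open>\<omega>\<^sub>1\<^sub>1\<close>, \<open>\<omega>\<^sub>1\<^sub>3\<close>, \<open>\<omega>\<^sub>1\<^sub>5\<close> of the square root transform of \<open>f\<close>, and \<open>\<gamma>\<^sub>3 = \<omega>\<^sub>1\<^sub>1\<^sup>3 / 3 + \<omega>\<^sub>1\<^sub>1 \<omega>\<^sub>1\<^sub>3 + \<omega>\<^sub>1\<^sub>5\<close>;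
  \<open>bound_root\<close> is the value of \<open>x\<^sup>2\<close> at which the maximum is attained.
\<close>

definition bound_root :: real where
  "bound_root = (THE t. 1/2 < t \<and> t < 1 \<and> 75 * t ^ 3 + 70 * t ^ 2 - 85 * t + 4 = 0)"

definition gamma3_bound :: real where
  "gamma3_bound =
     (5 * bound_root ^ 2 + 10 * bound_root - 2) / (15 * sqrt bound_root)"

lemma bound_root_aux:
  fixes s t :: real
  assumes "1/2 \<le> s" "s < t"
  shows "75 * s ^ 3 + 70 * s ^ 2 - 85 * s + 4 < 75 * t ^ 3 + 70 * t ^ 2 - 85 * t + 4"
proof -
  have "1/4 \<le> s * s" "1/4 \<le> t * s" "1/4 \<le> t * t"
    using mult_mono[of "1/2" s "1/2" s] mult_mono[of "1/2" t "1/2" s] mult_mono[of "1/2" t "1/2" t] assms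
    by auto
  then have "0 < 75 * (t * t + t * s + s * s) + 70 * (t + s) - 85"
    using assms by (simp add: algebra_simps)
  then have "0 < (t - s) * (75 * (t * t + t * s + s * s) + 70 * (t + s) - 85)"
    using assms by simp
  then show ?thesis
    by (simp add: algebra_simps power2_eq_square power3_eq_cube)
qed

lemma bound_root:
  "0.660434103 < bound_root" "bound_root < 0.660434104"
  "75 * bound_root ^ 3 + 70 * bound_root ^ 2 - 85 * bound_root + 4 = 0"
proof -
  let ?p = "\<lambda>t::real. 75 * t ^ 3 + 70 * t ^ 2 - 85 * t + 4"
  have neg: "?p 0.660434103 < 0" and pos: "?p 0.660434104 > 0"
    by (simp_all add: power2_eq_square power3_eq_cube)
  have "\<exists>t\<ge>0.660434103. t \<le> 0.660434104 \<and> ?p t = 0"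
    by (rule IVT'[of ?p, OF less_imp_le[OF neg] less_imp_le[OF pos]]) (auto intro!: continuous_intros)
  then obtain t where t: "0.660434103 \<le> t" "t \<le> 0.660434104" "?p t = 0"
    by blast
  have "t \<noteq> 0.660434103" "t \<noteq> 0.660434104"
    using t(3) neg pos by (metis less_irrefl)+
  with t have t': "0.660434103 < t" "t < 0.660434104" by auto
  have "bound_root = t"
    unfolding bound_root_def
  proof (rule the_equality)
    show "1/2 < t \<and> t < 1 \<and> ?p t = 0" using t t' by simp
    fix s assume s: "1/2 < s \<and> s < 1 \<and> ?p s = 0"
    show "s = t"
    proof (rule ccontr)
      assume "s \<noteq> t"
      then consider "s < t" | "t < s" by linarith
      then show False
        using bound_root_aux[of s t] bound_root_aux[of t s] s t by cases auto
    qed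
  qed
  with t t' show "0.660434103 < bound_root" "bound_root < 0.660434104" "?p bound_root = 0"
    by auto
qed

lemma gamma3_bound_digits: "0.5566178 \<le> gamma3_bound" "gamma3_bound < 0.5566179"
proof -
  let ?t = bound_root
  let ?N = "5 * ?t ^ 2 + 10 * ?t - 2"
  have lo: "0.8126709 < sqrt ?t"
    by (rule real_less_rsqrt) (use bound_root(1) in \<open>simp add: power2_eq_square\<close>)
  have hi: "sqrt ?t < 0.81267097"
    by (rule real_less_lsqrt) (use bound_root(1,2) in \<open>simp_all add: power2_eq_square\<close>)
  have "0.660434103 ^ 2 \<le> ?t ^ 2" "?t ^ 2 \<le> 0.660434104 ^ 2"
    using bound_root(1,2) by (intro power_mono; simp)+
  then have N: "6.78520704 \<le> ?N" "?N \<le> 6.78520708"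
    using bound_root(1,2) by (simp_all add: power2_eq_square)
  have pos: "0 < 15 * sqrt ?t" using bound_root(1) by simp
  show "0.5566178 \<le> gamma3_bound"
    unfolding gamma3_bound_def pos_le_divide_eq[OF pos] using hi N by simp
  show "gamma3_bound < 0.5566179"
    unfolding gamma3_bound_def pos_divide_less_eq[OF pos] using lo N by simp
qed

end

theory Submission
  imports Defs
begin

text \<open>
  Put \<open>E = exp (- F / 2)\<close>, where \<open>F\<close> is the branch of \<open>log (f z / z)\<close>. The function \<open>E (z\<^sup>2) / z\<close> is the
  reciprocal of the square root transform of \<open>f\<close>, hence injective on the punctured disk, and it
  equals \<open>1 / z - a z - b z\<^sup>3 - c z\<^sup>5 - \<dots>\<close> with \<open>\<gamma>\<^sub>3 = a\<^sup>3 / 3 + a b + c\<close>.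
  Gronwall's area theorem gives \<open>\<bar>a\<bar>\<^sup>2 + 3 \<bar>b\<bar>\<^sup>2 + 5 \<bar>c\<bar>\<^sup>2 \<le> 1\<close>, and the bound is the maximum of
  \<open>x\<^sup>3 / 3 + x y + z\<close> under this constraint.

  For the area theorem, let \<open>g z = 1 / z + b\<^sub>1 z + \<dots>\<close> be injective. The area of the image of the annulus
  \<open>\<rho> < \<bar>z\<bar> < r\<close> is found by changing variables with \<open>g \<circ> exp\<close> on a rectangle and applying Bessel's
  inequality on vertical lines. The image lies in a slightly enlarged ellipse, the image of the circle
  \<open>\<bar>z\<bar> = \<rho>\<close> under \<open>1 / z + b\<^sub>1 z\<close>; composing \<open>g\<close> with the real linear map \<open>w \<mapsto> w - b\<^sub>1 \<rho>\<^sup>2 cnj w\<close> turns this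
  ellipse into a disk, precisely enough for the errors to vanish as \<open>\<rho> \<rightarrow> 0\<close>.
\<close>

subsection \<open>Area of the image of a rectangle\<close>

definition complex_of_vec :: "real ^ 2 \<Rightarrow> complex" where
  "complex_of_vec v = Complex (v $ 1) (v $ 2)"

definition vec_of_complex :: "complex \<Rightarrow> real ^ 2" where
  "vec_of_complex z = vector [Re z, Im z]"

lemma complex_of_vec_of_complex [simp]: "complex_of_vec (vec_of_complex z) = z"
  by (simp add: complex_of_vec_def vec_of_complex_def)

lemma bounded_linear_complex_of_vec: "bounded_linear complex_of_vec"
  unfolding linear_conv_bounded_linear[symmetric]
  by (intro linearI) (simp_all add: complex_of_vec_def complex_eq_iff)

lemma bounded_linear_vec_of_complex: "bounded_linear vec_of_complex"
  unfolding linear_conv_bounded_linear[symmetric]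
  by (intro linearI) (simp_all add: vec_of_complex_def vec_eq_iff forall_2)

lemma norm_vec_of_complex [simp]: "norm (vec_of_complex z) = norm z"
  by (simp add: norm_vec_def L2_set_def sum_2 vec_of_complex_def cmod_def)

lemma inj_complex_of_vec: "inj complex_of_vec"
  by (rule injI) (simp add: complex_of_vec_def vec_eq_iff forall_2)

lemma inj_vec_of_complex: "inj vec_of_complex"
  by (metis complex_of_vec_of_complex injI)

text \<open>In Wirtinger terms \<open>p\<close> and \<open>q\<close> are the derivatives with
  respect to z and to its conjugate, so this is the Jacobian of a map that need not be holomorphic,
  such as the sheared map of the area theorem.\<close>

lemma det_matrix_complex_linear_antilinear:
  "det (matrix (\<lambda>v. vec_of_complex (p * complex_of_vec v + q * cnj (complex_of_vec v)))) =
     (norm p)\<^sup>2 - (norm q)\<^sup>2"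
  by (simp add: det_2 matrix_def vec_of_complex_def complex_of_vec_def axis_def cmod_power2)
     (simp add: algebra_simps power2_eq_square)

section \<open>Integration over rectangles in \<open>real ^ 2\<close>\<close>

lemma vector_cbox_image:
  fixes u v :: "real \<times> real"
  shows "(\<lambda>p. vector [fst p, snd p] :: real ^ 2) ` cbox u v = cbox (vector [fst u, snd u]) (vector [fst v, snd v])"
proof -
  have "x \<in> (\<lambda>p. vector [fst p, snd p] :: real ^ 2) ` cbox u v"
    if "x \<in> cbox (vector [fst u, snd u]) (vector [fst v, snd v])" for x
    by (rule image_eqI[of _ _ "(x $ 1, x $ 2)"])
       (use that in \<open>auto simp: vec_eq_iff forall_2 mem_box_cart cbox_Pair_eq mem_box Basis_prod_def inner_prod_def\<close>)
  then show ?thesis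
    by (auto simp: mem_box_cart forall_2 mem_box Basis_prod_def inner_prod_def)
qed

lemma vec_pair_cbox_image:
  "(\<lambda>x::real^2. (x $ 1, x $ 2)) ` cbox u v = cbox (u $ 1, u $ 2) (v $ 1, v $ 2)"
proof -
  have "p \<in> (\<lambda>x::real^2. (x $ 1, x $ 2)) ` cbox u v" if "p \<in> cbox (u $ 1, u $ 2) (v $ 1, v $ 2)" for p
    by (rule image_eqI[of _ _ "vector [fst p, snd p]"])
       (use that in \<open>auto simp: mem_box_cart forall_2 cbox_Pair_eq\<close>)
  then show ?thesis
    by (auto simp: mem_box_cart forall_2 cbox_Pair_eq)
qed

text \<open>The change of variables below takes place in \<open>real ^ 2\<close>, iterated
  integration in \<open>real \<times> real\<close>. The coordinate bijection between the two
  preserves the content of boxes, hence integrals.\<close>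

lemma integral_cbox_vec2:
  fixes f :: "real \<Rightarrow> real \<Rightarrow> real"
  assumes "continuous_on (cbox (a, c) (b, d)) (\<lambda>(x, y). f x y)"
  shows "((\<lambda>v. f (v $ 1) (v $ 2)) has_integral integral {a..b} (\<lambda>x. integral {c..d} (f x)))
           (cbox (vector [a, c]) (vector [b, d] :: real ^ 2))"
proof -
  let ?g = "\<lambda>v::real^2. (v $ 1, v $ 2)" and ?h = "\<lambda>p. vector [fst p, snd p] :: real^2"
  have cont: "measure lborel (?g ` cbox u v) = 1 * measure lborel (cbox u v)" for u v
  proof (cases "cbox u v = {}")
    case False
    then have "u $ 1 \<le> v $ 1" "u $ 2 \<le> v $ 2"
      by (auto simp: interval_eq_empty_cart forall_2 not_less)
    then show ?thesis
      using False by (simp add: vec_pair_cbox_image content_Pair content_cbox_cart UNIV_2)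
  qed simp
  have "((\<lambda>(x, y). f x y) has_integral integral (cbox (a, c) (b, d)) (\<lambda>(x, y). f x y)) (cbox (a, c) (b, d))"
    using assms by (intro integrable_integral integrable_continuous)
  then have "((\<lambda>v. (\<lambda>(x, y). f x y) (?g v)) has_integral (1 / 1) *\<^sub>R integral (cbox (a, c) (b, d)) (\<lambda>(x, y). f x y)) (?h ` cbox (a, c) (b, d))"
    by (intro has_integral_twiddle[OF zero_less_one _ _ _ _ _ cont])
       (auto simp: vec_eq_iff forall_2 vector_cbox_image vec_pair_cbox_image intro!: continuous_intros)
  then show ?thesis
    by (simp add: vector_cbox_image integral_prod_continuous[OF assms])
qed

text \<open>For an injective map the integral of the absolute Jacobian is the area of the image,
  here at most that of the surrounding disk. Injectivity is asked on the open box because the map it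
  is applied to has period \<open>2 * pi * \<i>\<close> and agrees on the two horizontal
  sides.\<close>

lemma integral_jacobian_le_disc_area:
  fixes \<psi> p q :: "complex \<Rightarrow> complex"
  assumes p: "continuous_on (cbox (Complex a c) (Complex b d)) p"
    and q: "continuous_on (cbox (Complex a c) (Complex b d)) q"
    and der: "\<And>z. z \<in> box (Complex a c) (Complex b d) \<Longrightarrow> (\<psi> has_derivative (\<lambda>h. p z * h + q z * cnj h)) (at z)"
    and inj: "inj_on \<psi> (box (Complex a c) (Complex b d))"
    and img: "\<psi> ` box (Complex a c) (Complex b d) \<subseteq> cball 0 R"
    and R: "R \<ge> 0"
  shows "integral {a..b} (\<lambda>x. integral {c..d} (\<lambda>y. \<bar>(norm (p (Complex x y)))\<^sup>2 - (norm (q (Complex x y)))\<^sup>2\<bar>)) \<le> pi * R\<^sup>2"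
    (is "?I \<le> _")
proof -
  let ?S = "box (vector [a, c]) (vector [b, d] :: real ^ 2)"
  let ?J = "\<lambda>z. \<bar>(norm (p z))\<^sup>2 - (norm (q z))\<^sup>2\<bar>"
  define \<Phi> where "\<Phi> v = vec_of_complex (\<psi> (complex_of_vec v))" for v
  define \<Phi>' where "\<Phi>' v = (\<lambda>h. vec_of_complex (p (complex_of_vec v) * complex_of_vec h + q (complex_of_vec v) * cnj (complex_of_vec h)))" for v
  have S: "complex_of_vec v \<in> box (Complex a c) (Complex b d)" if "v \<in> ?S" for v
    using that by (auto simp: complex_of_vec_def in_box_complex_iff mem_box_cart forall_2)
  have d: "(\<Phi> has_derivative \<Phi>' v) (at v within ?S)" if "v \<in> ?S" for v
  proof -
    have "(complex_of_vec has_derivative complex_of_vec) (at v)"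
      by (rule bounded_linear_imp_has_derivative[OF bounded_linear_complex_of_vec])
    from has_derivative_compose[OF this der[OF S[OF that]]]
    have "((\<lambda>v. \<psi> (complex_of_vec v)) has_derivative (\<lambda>h. p (complex_of_vec v) * complex_of_vec h + q (complex_of_vec v) * cnj (complex_of_vec h))) (at v)" .
    from bounded_linear.has_derivative[OF bounded_linear_vec_of_complex this]
    show ?thesis unfolding \<Phi>_def \<Phi>'_def by (rule has_derivative_at_withinI)
  qed
  have injS: "inj_on \<Phi> ?S"
  proof (rule inj_onI)
    fix u v assume uv: "u \<in> ?S" "v \<in> ?S" "\<Phi> u = \<Phi> v"
    then have "\<psi> (complex_of_vec u) = \<psi> (complex_of_vec v)"
      using inj_vec_of_complex by (auto simp: \<Phi>_def dest: injD)
    then have "complex_of_vec u = complex_of_vec v"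
      using inj S uv by (auto dest: inj_onD)
    then show "u = v" using inj_complex_of_vec by (auto dest: injD)
  qed
  have J: "((\<lambda>v. \<bar>det (matrix (\<Phi>' v))\<bar>) has_integral ?I) ?S"
  proof -
    have "continuous_on (cbox (a, c) (b, d)) (\<lambda>(x, y). ?J (Complex x y))"
    proof -
      have *: "continuous_on (cbox (a, c) (b, d)) (\<lambda>z. Complex (fst z) (snd z))"
        by (simp add: Complex_eq) (intro continuous_intros)
      have sub: "(\<lambda>z. Complex (fst z) (snd z)) ` cbox (a, c) (b, d) \<subseteq> cbox (Complex a c) (Complex b d)"
        by (auto simp: in_cbox_complex_iff cbox_Pair_eq)
      show ?thesis
        unfolding case_prod_unfold
        by (intro continuous_intros continuous_on_compose2[OF p * sub] continuous_on_compose2[OF q * sub])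
    qed
    from integral_cbox_vec2[OF this]
    have "((\<lambda>v. ?J (complex_of_vec v)) has_integral ?I) ?S"
      unfolding complex_of_vec_def by (simp add: has_integral_open_interval)
    then show ?thesis
      by (simp add: \<Phi>'_def det_matrix_complex_linear_antilinear)
  qed
  have "?S \<in> sets lebesgue" by simp
  from has_measure_differentiable_image[OF this d injS, of ?I] J
  have m: "\<Phi> ` ?S \<in> lmeasurable" "measure lebesgue (\<Phi> ` ?S) = ?I" by auto
  have "\<Phi> ` ?S \<subseteq> cball 0 R"
    using img S by (force simp: \<Phi>_def image_subset_iff)
  then have "measure lebesgue (\<Phi> ` ?S) \<le> measure lebesgue (cball 0 R :: (real ^ 2) set)"
    using m by (intro measure_mono_fmeasurable) auto
  also have "\<dots> = pi * R\<^sup>2"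
    using R by (simp add: measure_completion content_cball_conv_ball circle_area)
  finally show ?thesis using m by simp
qed

subsection \<open>The area theorem\<close>

text \<open>Cauchy's formula for the k-th derivative at 0, read on the circle of radius
  \<open>s\<close>: the Fourier coefficients of \<open>F\<close> there are its scaled Taylor
  coefficients.\<close>

lemma has_integral_circle_coeff:
  fixes F :: "complex \<Rightarrow> complex"
  assumes F: "F holomorphic_on ball 0 1" "F has_fps_expansion A" and s: "0 < s" "s < 1"
  shows "((\<lambda>y. F (of_real s * cis y) * cnj (cis y) ^ k) has_integral 2 * pi * fps_nth A k * of_real s ^ k) {0..2*pi}"
proof -
  have cont: "continuous_on (cball 0 s) F"
    using F(1) s by (auto intro!: holomorphic_on_imp_continuous_on elim: holomorphic_on_subset)
  have hol: "F holomorphic_on ball 0 s"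
    using F(1) s by (auto elim: holomorphic_on_subset)
  have "((\<lambda>u. F u / (u - 0) ^ Suc k) has_contour_integral (2 * pi * \<i>) / fact k * (deriv ^^ k) F 0) (circlepath 0 s)"
    by (rule Cauchy_has_contour_integral_higher_derivative_circlepath[OF cont hol]) (use s in auto)
  then have "((\<lambda>u. F u / u ^ Suc k) has_contour_integral 2 * pi * \<i> * fps_nth A k) (part_circlepath 0 s 0 (2 * pi))"
    by (simp add: circlepath_def fps_nth_fps_expansion[OF F(2)] field_simps)
  then have "((\<lambda>y. F (of_real s * cis y) / (of_real s * cis y) ^ Suc k * s * \<i> * cis y) has_integral 2 * pi * \<i> * fps_nth A k) {0..2*pi}"
    by (subst (asm) has_contour_integral_part_circlepath_iff) auto
  \<comment> \<open>This factor turns \<open>F u / u ^ Suc k\<close> times du into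
    \<open>F u * cnj (cis y) ^ k\<close> times dy.\<close>
  from has_integral_mult_right[OF this, of "of_real s ^ k / \<i>"]
  have *: "((\<lambda>y. of_real s ^ k / \<i> * (F (of_real s * cis y) / (of_real s * cis y) ^ Suc k * s * \<i> * cis y))
             has_integral 2 * pi * fps_nth A k * of_real s ^ k) {0..2*pi}"
    by (simp add: mult_ac)
  have "of_real s ^ k / \<i> * (F (of_real s * cis y) / (of_real s * cis y) ^ Suc k * s * \<i> * cis y) =
          F (of_real s * cis y) * cnj (cis y) ^ k" for y
  proof -
    have "cnj (cis y) = inverse (cis y)"
      by (simp add: cis_cnj)
    then have c: "cnj (cis y) ^ k = inverse (cis y ^ k)"
      by (simp only: power_inverse)
    have s0: "complex_of_real s \<noteq> 0" "cis y \<noteq> 0"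
      using s by auto
    have ii: "\<i> * (x * \<i>) = - x" for x
      by (simp add: mult.left_commute[of \<i> x])
    show ?thesis
      unfolding c power_mult_distrib power_Suc using s0 by (simp add: divide_simps ii)
  qed
  with * show ?thesis by simp
qed

text \<open>Bessel's inequality: integrate the nonnegative square of \<open>norm (F - P)\<close> for
  the Taylor polynomial \<open>P\<close> of degree at most \<open>N\<close>. Only finite sums
  occur.\<close>

lemma bessel_circle:
  fixes F :: "complex \<Rightarrow> complex"
  assumes F: "F holomorphic_on ball 0 1" "F has_fps_expansion A" and s: "0 < s" "s < 1"
  shows "2 * pi * (\<Sum>k\<le>N. (norm (fps_nth A k))\<^sup>2 * s ^ (2 * k)) \<le> integral {0..2*pi} (\<lambda>y. (norm (F (of_real s * cis y)))\<^sup>2)"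
proof -
  define P where "P z = (\<Sum>k\<le>N. fps_nth A k * z ^ k)" for z
  let ?B = "\<Sum>k\<le>N. (norm (fps_nth A k))\<^sup>2 * s ^ (2 * k)"
  let ?z = "\<lambda>y. of_real s * cis y"
  have P: "P holomorphic_on ball 0 1"
    unfolding P_def by (intro holomorphic_intros)
  have Pe: "P has_fps_expansion Abs_fps (\<lambda>k. if k \<le> N then fps_nth A k else 0)"
  proof (rule has_fps_expansionI, rule always_eventually, rule allI)
    fix u :: complex
    show "(\<lambda>n. fps_nth (Abs_fps (\<lambda>k. if k \<le> N then fps_nth A k else 0)) n * u ^ n) sums P u"
      using sums_If_finite_set[of "{..N}" "\<lambda>k. fps_nth A k * u ^ k"]
      by (simp add: P_def if_distrib[of "\<lambda>x. x * _"] cong: if_cong)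
  qed
  \<comment> \<open>The inner product with \<open>P\<close> sees only the coefficients up to
    \<open>N\<close>, so \<open>F\<close> and \<open>P\<close> give the same value. The fact is used
    for both.\<close>
  have *: "((\<lambda>y. Q (?z y) * cnj (P (?z y))) has_integral of_real (2 * pi * ?B)) {0..2*pi}"
    if Q: "Q holomorphic_on ball 0 1" "Q has_fps_expansion C" "\<And>k. k \<le> N \<Longrightarrow> fps_nth C k = fps_nth A k" for Q C
  proof -
    have "((\<lambda>y. \<Sum>k\<le>N. cnj (fps_nth A k) * s ^ k * (Q (?z y) * cnj (cis y) ^ k)) has_integral
            (\<Sum>k\<le>N. cnj (fps_nth A k) * s ^ k * (2 * pi * fps_nth C k * of_real s ^ k))) {0..2*pi}"
      by (intro has_integral_sum has_integral_mult_right has_integral_circle_coeff[OF Q(1,2) s]) (rule finite_atMost)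
    moreover have "(\<Sum>k\<le>N. cnj (fps_nth A k) * s ^ k * (2 * pi * fps_nth C k * of_real s ^ k)) = of_real (2 * pi * ?B)"
      unfolding sum_distrib_left of_real_sum
    proof (rule sum.cong)
      fix k assume k: "k \<in> {..N}"
      have s2: "s ^ (2 * k) = s ^ k * s ^ k"
        by (simp add: mult_2 power_add)
      have sq: "complex_of_real ((norm (fps_nth A k))\<^sup>2) = fps_nth A k * cnj (fps_nth A k)"
        by (simp only: complex_norm_square)
      show "cnj (fps_nth A k) * s ^ k * (2 * pi * fps_nth C k * of_real s ^ k) = complex_of_real (2 * pi * ((norm (fps_nth A k))\<^sup>2 * s ^ (2 * k)))"
        unfolding of_real_mult sq using Q(3)[of k] k by (simp add: s2)
    qed simp
    moreover have "(\<Sum>k\<le>N. cnj (fps_nth A k) * s ^ k * (Q (?z y) * cnj (cis y) ^ k)) = Q (?z y) * cnj (P (?z y))" for y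
      unfolding P_def by (simp add: sum_distrib_left power_mult_distrib mult_ac)
    ultimately show ?thesis by simp
  qed
  have mem: "?z y \<in> ball 0 1" for y
    using s by (simp add: norm_mult)
  have c: "continuous_on {0..2*pi} ?z"
    by (intro continuous_intros)
  have "((\<lambda>y. 2 * Re (F (?z y) * cnj (P (?z y))) - Re (P (?z y) * cnj (P (?z y)))) has_integral
          2 * Re (of_real (2 * pi * ?B)) - Re (of_real (2 * pi * ?B))) {0..2*pi}"
    by (intro has_integral_diff has_integral_mult_right has_integral_Re *[OF F] *[OF P Pe]) auto
  moreover have "((\<lambda>y. (norm (F (?z y)))\<^sup>2) has_integral integral {0..2*pi} (\<lambda>y. (norm (F (?z y)))\<^sup>2)) {0..2*pi}"
    by (intro integrable_integral integrable_continuous_real continuous_intros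
          continuous_on_compose2[OF holomorphic_on_imp_continuous_on[OF F(1)] c])
       (use mem in blast)
  ultimately have "2 * Re (of_real (2 * pi * ?B)) - Re (of_real (2 * pi * ?B)) \<le> integral {0..2*pi} (\<lambda>y. (norm (F (?z y)))\<^sup>2)"
  proof (rule has_integral_le)
    fix y
    have "(norm (F (?z y) - P (?z y)))\<^sup>2 = (norm (F (?z y)))\<^sup>2 - (2 * Re (F (?z y) * cnj (P (?z y))) - Re (P (?z y) * cnj (P (?z y))))"
      by (simp add: cmod_power2) (simp add: power2_eq_square algebra_simps)
    then show "2 * Re (F (?z y) * cnj (P (?z y))) - Re (P (?z y) * cnj (P (?z y))) \<le> (norm (F (?z y)))\<^sup>2"
      using zero_le_power2[of "norm (F (?z y) - P (?z y))"] by linarith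
  qed
  then show ?thesis by simp
qed

text \<open>On the circle of radius \<open>\<rho>\<close> the conjugate of 1 / z is
  \<open>z / \<rho>\<^sup>2\<close>, so the shear cancels the term \<open>b * z\<close> there and
  leaves 1 / z up to order \<open>\<rho>\<^sup>2\<close>. Without the shear the radius would have an
  error of order \<open>\<rho>\<close>, whose contribution to the squared radius does not vanish as
  \<open>\<rho>\<close> tends to 0.\<close>

lemma shear_bound:
  fixes b e z :: complex and \<rho> C :: real
  assumes \<rho>: "0 < \<rho>" "\<rho> \<le> norm z" "norm z < 1"
    and e: "norm e \<le> C * (norm z)\<^sup>2"
    and K: "K = (norm b)\<^sup>2 + C + norm b * C" and small: "\<rho> * (2 * norm b + 2 * K) \<le> 1"
  shows "norm ((1 / z + b * z + e) - b * of_real (\<rho>\<^sup>2) * cnj (1 / z + b * z + e)) \<le> 1 / \<rho> + K * \<rho>\<^sup>2"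
proof -
  define \<sigma> where "\<sigma> = norm z"
  define \<beta> where "\<beta> = norm b"
  have \<sigma>: "0 < \<sigma>" "\<rho> \<le> \<sigma>" "\<sigma> < 1" using \<rho> by (auto simp: \<sigma>_def)
  have z: "z \<noteq> 0" using \<rho> by auto
  have \<beta>: "\<beta> \<ge> 0" by (simp add: \<beta>_def)
  have "0 \<le> C * \<sigma>\<^sup>2" using e norm_ge_zero[of e] unfolding \<sigma>_def by linarith
  then have C: "C \<ge> 0" using \<sigma> by (simp add: zero_le_mult_iff)
  have K0: "K \<ge> 0" using C by (simp add: K)
  have zz: "z * cnj z = of_real (\<sigma>\<^sup>2)"
    by (simp add: \<sigma>_def complex_norm_square[symmetric] del: of_real_power)
  \<comment> \<open>The cancellation: the last factor is 0 for
    \<open>\<sigma> = \<rho>\<close>.\<close>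
  have "b * z - b * of_real (\<rho>\<^sup>2) * cnj (1 / z) = b * z * of_real (1 - \<rho>\<^sup>2 / \<sigma>\<^sup>2)"
  proof -
    have "cnj (1 / z) = z / of_real (\<sigma>\<^sup>2)"
      using z by (simp add: zz[symmetric] del: of_real_power)
    then show ?thesis by (simp add: algebra_simps)
  qed
  then have eq: "(1 / z + b * z + e) - b * of_real (\<rho>\<^sup>2) * cnj (1 / z + b * z + e) =
      1 / z + b * z * of_real (1 - \<rho>\<^sup>2 / \<sigma>\<^sup>2) + e - b * of_real (\<rho>\<^sup>2) * cnj (b * z) - b * of_real (\<rho>\<^sup>2) * cnj e"
    by (simp add: algebra_simps)
  have le1: "\<rho>\<^sup>2 / \<sigma>\<^sup>2 \<le> 1"
    using \<rho> \<sigma> by (simp add: power_mono)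
  have \<rho>1: "\<rho>\<^sup>2 \<le> 1"
    using \<rho> by (intro power_le_one) auto
  have \<rho>\<sigma>: "\<rho>\<^sup>2 \<le> \<sigma>\<^sup>2" "\<sigma>\<^sup>2 \<le> \<sigma>"
    using \<rho> \<sigma> power_mono[of \<rho> \<sigma> 2] by (simp_all add: power2_eq_square)
  have n1: "norm (1 / z) = 1 / \<sigma>" by (simp add: \<sigma>_def norm_divide)
  have n2: "norm (b * z * of_real (1 - \<rho>\<^sup>2 / \<sigma>\<^sup>2)) = \<beta> * (\<sigma> - \<rho>\<^sup>2 / \<sigma>)"
    using le1 \<sigma> by (simp add: norm_mult \<sigma>_def[symmetric] \<beta>_def[symmetric] del: of_real_diff of_real_divide)
       (simp add: field_simps power2_eq_square)
  have n3: "norm e \<le> C * \<sigma>\<^sup>2" using e by (simp add: \<sigma>_def)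
  have "norm (b * of_real (\<rho>\<^sup>2) * cnj (b * z)) = \<beta>\<^sup>2 * (\<rho>\<^sup>2 * \<sigma>)"
    by (simp add: norm_mult \<sigma>_def \<beta>_def power2_eq_square)
  also have "\<dots> \<le> \<beta>\<^sup>2 * (\<sigma>\<^sup>2 * 1)"
    using \<rho>\<sigma> \<sigma> by (intro mult_left_mono mult_mono) auto
  finally have n4: "norm (b * of_real (\<rho>\<^sup>2) * cnj (b * z)) \<le> \<beta>\<^sup>2 * \<sigma>\<^sup>2" by simp
  have "norm (b * of_real (\<rho>\<^sup>2) * cnj e) = \<beta> * \<rho>\<^sup>2 * norm e"
    by (simp add: norm_mult norm_power \<beta>_def)
  also have "\<dots> \<le> \<beta> * 1 * (C * \<sigma>\<^sup>2)"
    using \<rho>1 \<beta> n3 by (intro mult_mono) auto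
  finally have n5: "norm (b * of_real (\<rho>\<^sup>2) * cnj e) \<le> \<beta> * C * \<sigma>\<^sup>2" by simp
  have "norm ((1 / z + b * z + e) - b * of_real (\<rho>\<^sup>2) * cnj (1 / z + b * z + e)) \<le>
     1 / \<sigma> + \<beta> * (\<sigma> - \<rho>\<^sup>2 / \<sigma>) + C * \<sigma>\<^sup>2 + \<beta>\<^sup>2 * \<sigma>\<^sup>2 + \<beta> * C * \<sigma>\<^sup>2"
    unfolding eq
    by (intro order.trans[OF norm_triangle_ineq4] order.trans[OF norm_triangle_ineq] add_mono)
       (use n1 n2 n3 n4 n5 in auto)
  also have "\<dots> = 1 / \<sigma> + \<beta> * (\<sigma> - \<rho>\<^sup>2 / \<sigma>) + K * \<sigma>\<^sup>2"
    by (simp add: K \<beta>_def algebra_simps)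
  also have "\<dots> \<le> 1 / \<rho> + K * \<rho>\<^sup>2"
  proof -
    \<comment> \<open>Moving from \<open>\<sigma>\<close> to \<open>\<rho>\<close>, the other two
      terms change by at most \<open>(2 * \<beta> + 2 * K) * (\<sigma> - \<rho>)\<close>. The gain
      \<open>1 / \<rho> - 1 / \<sigma> = (\<sigma> - \<rho>) / (\<rho> * \<sigma>)\<close> outweighs
      this by \<open>small\<close>.\<close>
    have a: "\<beta> * (\<sigma> - \<rho>\<^sup>2 / \<sigma>) \<le> \<beta> * (2 * (\<sigma> - \<rho>))"
    proof (rule mult_left_mono)
      have "0 \<le> (\<sigma> - \<rho>)\<^sup>2 / \<sigma>" using \<sigma> by simp
      also have "\<dots> = 2 * (\<sigma> - \<rho>) - (\<sigma> - \<rho>\<^sup>2 / \<sigma>)"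
        using \<sigma> by (simp add: field_simps power2_eq_square)
      finally show "\<sigma> - \<rho>\<^sup>2 / \<sigma> \<le> 2 * (\<sigma> - \<rho>)" by simp
    qed fact
    have "(\<sigma> - \<rho>) * (\<sigma> + \<rho>) \<le> (\<sigma> - \<rho>) * 2"
      using \<sigma> by (intro mult_left_mono) auto
    then have "\<sigma>\<^sup>2 - \<rho>\<^sup>2 \<le> 2 * (\<sigma> - \<rho>)"
      by (simp add: power2_eq_square algebra_simps)
    then have b: "K * (\<sigma>\<^sup>2 - \<rho>\<^sup>2) \<le> K * (2 * (\<sigma> - \<rho>))"
      using K0 by (rule mult_left_mono)
    have "(2 * \<beta> + 2 * K) * (\<rho> * \<sigma>) \<le> 1 * 1"
      unfolding mult.assoc[symmetric]
      by (rule mult_mono) (use small \<sigma> \<rho> in \<open>auto simp: \<beta>_def mult.commute\<close>)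
    then have "2 * \<beta> + 2 * K \<le> 1 / (\<rho> * \<sigma>)"
      using \<rho> \<sigma> by (simp add: field_simps)
    then have "(\<sigma> - \<rho>) * (2 * \<beta> + 2 * K) \<le> (\<sigma> - \<rho>) * (1 / (\<rho> * \<sigma>))"
      using \<sigma> by (intro mult_left_mono) auto
    also have "\<dots> = 1 / \<rho> - 1 / \<sigma>"
      using \<rho> \<sigma> by (simp add: field_simps)
    finally show ?thesis using a b by (simp add: algebra_simps)
  qed
  finally show ?thesis .
qed

text \<open>Two removable singularities write the remainder as \<open>G2 z * z\<^sup>2\<close> with
  \<open>G2\<close> holomorphic, and \<open>G2\<close> is bounded on the compact disk.\<close>

lemma second_order_remainder_bound:
  assumes G: "G holomorphic_on ball 0 1" "G 0 = 0" and r: "r < 1"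
  obtains C where "C \<ge> 0" "\<And>z. norm z \<le> r \<Longrightarrow> norm (G z - deriv G 0 * z) \<le> C * (norm z)\<^sup>2"
proof -
  define G1 where "G1 z = (if z = 0 then deriv G 0 else (G z - G 0) / (z - 0))" for z
  have G1: "G1 holomorphic_on ball 0 1"
    unfolding G1_def by (rule pole_lemma_open[OF G(1)]) auto
  define G2 where "G2 z = (if z = 0 then deriv G1 0 else (G1 z - G1 0) / (z - 0))" for z
  have G2: "G2 holomorphic_on ball 0 1"
    unfolding G2_def by (rule pole_lemma_open[OF G1]) auto
  have "continuous_on (cball 0 r) G2"
    using G2 r by (auto intro!: holomorphic_on_imp_continuous_on elim: holomorphic_on_subset)
  then have "bounded (G2 ` cball 0 r)"
    by (intro compact_imp_bounded compact_continuous_image compact_cball)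
  then obtain C where C: "C > 0" "\<And>z. norm z \<le> r \<Longrightarrow> norm (G2 z) \<le> C"
    unfolding bounded_pos by auto
  have "G z - deriv G 0 * z = G2 z * z\<^sup>2" for z
    by (auto simp: G1_def G2_def G(2) power2_eq_square field_simps)
  then have "norm (G z - deriv G 0 * z) \<le> C * (norm z)\<^sup>2" if "norm z \<le> r" for z
    using C(2)[OF that] by (simp add: norm_mult norm_power mult_right_mono)
  with C(1) that show ?thesis by (metis less_imp_le)
qed

text \<open>Up to the factor pi, the right side is the area of the disk from
  \<open>shear_bound\<close>, and the left side is a lower bound for the area of the sheared image
  of the annulus, the first factor being the Jacobian of the shear. \<open>K\<close> and
  \<open>\<epsilon>\<close> are chosen before \<open>\<rho>\<close>, so that \<open>\<rho>\<close>
  can tend to 0.\<close>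

lemma area_annulus:
  assumes G: "G holomorphic_on ball 0 1" "G has_fps_expansion B" "G 0 = 0"
    and inj: "inj_on (\<lambda>z. 1 / z + G z) (ball 0 1 - {0})"
    and r: "0 < r" "r < 1"
  obtains K \<epsilon> where "\<epsilon> > 0"
    "\<And>\<rho>. 0 < \<rho> \<Longrightarrow> \<rho> < \<epsilon> \<Longrightarrow> \<rho> < r \<Longrightarrow>
      (1 - (norm (fps_nth B 1))\<^sup>2 * \<rho> ^ 4) *
        (1 / \<rho>\<^sup>2 - 1 / r\<^sup>2 + (\<Sum>n=1..N. n * (norm (fps_nth B n))\<^sup>2 * (r ^ (2 * n) - \<rho> ^ (2 * n)))) \<le> (1 / \<rho> + K * \<rho>\<^sup>2)\<^sup>2"
proof -
  define b where "b = fps_nth B 1"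
  have b: "b = deriv G 0"
    using fps_nth_fps_expansion[OF G(2), of 1] by (simp add: b_def)
  obtain C where C: "C \<ge> 0" "\<And>z. norm z \<le> r \<Longrightarrow> norm (G z - b * z) \<le> C * (norm z)\<^sup>2"
    using second_order_remainder_bound[OF G(1,3) r(2)] unfolding b by metis
  define K where "K = (norm b)\<^sup>2 + C + norm b * C"
  have K: "K \<ge> 0" using C by (simp add: K_def)
  define \<epsilon> where "\<epsilon> = 1 / (2 * norm b + 2 * K + 1)"
  have den: "2 * norm b + 2 * K + 1 > 0" using K by (simp add: add_nonneg_pos)
  have \<epsilon>: "\<epsilon> > 0" using den by (simp add: \<epsilon>_def)
  \<comment> \<open>\<open>F\<close> is z squared times the derivative of 1 / z + G z. The factor
    removes the pole, and the derivative of g (exp u) becomes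
    \<open>F (exp u) / exp u\<close>.\<close>
  define F where "F z = z\<^sup>2 * deriv G z - 1" for z
  define A where "A = fps_X\<^sup>2 * fps_deriv B - 1"
  have F: "F holomorphic_on ball 0 1"
    unfolding F_def by (intro holomorphic_intros G) auto
  have FA: "F has_fps_expansion A"
    unfolding F_def A_def by (intro fps_expansion_intros G)
  have A: "fps_nth A 0 = -1" "fps_nth A 1 = 0" "\<And>n. fps_nth A (Suc n) = of_nat n * fps_nth B n"
  proof -
    have "fps_nth A (Suc n) = of_nat n * fps_nth B n" for n
      by (cases n) (simp_all add: A_def power2_eq_square mult.assoc)
    from this[of 0] this show "fps_nth A 0 = -1" "fps_nth A 1 = 0" "\<And>n. fps_nth A (Suc n) = of_nat n * fps_nth B n"
      by (simp_all add: A_def power2_eq_square)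
  qed
  have main: "(1 - (norm b)\<^sup>2 * \<rho> ^ 4) *
        (1 / \<rho>\<^sup>2 - 1 / r\<^sup>2 + (\<Sum>n=1..N. n * (norm (fps_nth B n))\<^sup>2 * (r ^ (2 * n) - \<rho> ^ (2 * n)))) \<le> (1 / \<rho> + K * \<rho>\<^sup>2)\<^sup>2"
    if \<rho>: "0 < \<rho>" "\<rho> < \<epsilon>" "\<rho> < r" for \<rho>
  proof -
    have small: "\<rho> * (2 * norm b + 2 * K) \<le> 1"
    proof -
      have "\<rho> * (2 * norm b + 2 * K + 1) \<le> 1"
        using \<rho>(2) den by (simp add: \<epsilon>_def field_simps)
      then show ?thesis using \<rho> by (simp add: algebra_simps)
    qed
    define g where "g z = 1 / z + G z" for z
    define \<psi> where "\<psi> u = g (exp u) - b * of_real (\<rho>\<^sup>2) * cnj (g (exp u))" for u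
    define p where "p u = F (exp u) / exp u" for u
    define q where "q u = - b * of_real (\<rho>\<^sup>2) * cnj (p u)" for u
    let ?a = "ln \<rho>" and ?d = "ln r"
    let ?box = "box (Complex ?a 0) (Complex ?d (2 * pi))"
    let ?cbox = "cbox (Complex ?a 0) (Complex ?d (2 * pi))"
    define m where "m = 1 - (norm b)\<^sup>2 * \<rho> ^ 4"
    \<comment> \<open>This makes the shear injective and its Jacobian \<open>m\<close>
      positive.\<close>
    have bm: "norm b * \<rho>\<^sup>2 < 1"
    proof -
      have "\<rho> * norm b \<le> 1 / 2"
      proof -
        have "0 \<le> \<rho> * K" using K \<rho> by simp
        moreover have "2 * (\<rho> * norm b) + 2 * (\<rho> * K) \<le> 1"
          using small by (simp add: algebra_simps)
        ultimately show ?thesis by linarith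
      qed
      then have "(\<rho> * norm b) * \<rho> \<le> 1/2 * 1"
        using \<rho> r by (intro mult_mono) auto
      then show ?thesis by (simp add: power2_eq_square mult_ac)
    qed
    have m: "m > 0"
    proof -
      have "(norm b * \<rho>\<^sup>2)\<^sup>2 < 1"
        using bm by (simp add: abs_square_less_1)
      then show ?thesis by (simp add: m_def power_mult_distrib)
    qed
    have ex: "norm (exp u) \<le> r" "\<rho> \<le> norm (exp u)" if "u \<in> ?cbox" for u
    proof -
      have "?a \<le> Re u" "Re u \<le> ?d" using that by (auto simp: in_cbox_complex_iff)
      then show "norm (exp u) \<le> r" "\<rho> \<le> norm (exp u)"
        using \<rho> r exp_le_cancel_iff[of "Re u" ?d] exp_le_cancel_iff[of ?a "Re u"] by (simp_all add: norm_exp_eq_Re)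
    qed
    have ex1: "exp u \<in> ball 0 1" if "u \<in> ?cbox" for u
      unfolding mem_ball_0 using ex(1)[OF that] r by linarith
    have sub: "u \<in> ?cbox" if "u \<in> ?box" for u
      using that box_subset_cbox by blast
    have cp: "continuous_on ?cbox p"
      unfolding p_def
    proof (intro continuous_intros continuous_on_compose2[OF holomorphic_on_imp_continuous_on[OF F]])
      show "exp ` ?cbox \<subseteq> ball 0 1"
        using ex1 by blast
    qed auto
    have cq: "continuous_on ?cbox q"
      unfolding q_def by (intro continuous_intros cp)
    have d: "(\<psi> has_derivative (\<lambda>h. p u * h + q u * cnj h)) (at u)" if u: "u \<in> ?box" for u
    proof -
      have "(G has_field_derivative deriv G (exp u)) (at (exp u))"
        by (rule holomorphic_derivI[OF G(1) open_ball ex1[OF sub[OF u]]])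
      then have "(g has_field_derivative - 1 / (exp u)\<^sup>2 + deriv G (exp u)) (at (exp u))"
        unfolding g_def by (auto intro!: derivative_eq_intros simp: power2_eq_square)
      then have "((\<lambda>u. g (exp u)) has_field_derivative (- 1 / (exp u)\<^sup>2 + deriv G (exp u)) * exp u) (at u)"
        by (rule DERIV_chain2) (rule DERIV_exp)
      moreover have "(- 1 / (exp u)\<^sup>2 + deriv G (exp u)) * exp u = p u"
        by (simp add: p_def F_def field_simps power2_eq_square)
      ultimately have *: "((\<lambda>u. g (exp u)) has_derivative (\<lambda>h. p u * h)) (at u)"
        by (simp add: has_field_derivative_def)
      show ?thesis
        unfolding \<psi>_def q_def
        by (rule has_derivative_eq_rhs[OF has_derivative_diff[OF * has_derivative_mult_right[OF has_derivative_cnj[OF *]]]])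
           (simp add: fun_eq_iff algebra_simps)
    qed
    have injb: "inj_on \<psi> ?box"
    proof (rule inj_onI)
      fix u v assume uv: "u \<in> ?box" "v \<in> ?box" "\<psi> u = \<psi> v"
      define D where "D = g (exp u) - g (exp v)"
      \<comment> \<open>Comparing norms forces \<open>D = 0\<close>, as the factor
        \<open>norm b * \<rho>\<^sup>2\<close> is below 1.\<close>
      have "D = b * of_real (\<rho>\<^sup>2) * cnj D"
        using uv(3) by (simp add: \<psi>_def D_def algebra_simps)
      then have "norm D = norm b * \<rho>\<^sup>2 * norm D"
        by (metis complex_mod_cnj norm_mult norm_of_real abs_power2 power2_abs)
      then have "D = 0" using bm by auto
      then have "g (exp u) = g (exp v)" by (simp add: D_def)
      then have "exp u = exp v"
        using inj_onD[OF inj, of "exp u" "exp v"] ex1[OF sub[OF uv(1)]] ex1[OF sub[OF uv(2)]]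
          exp_not_eq_zero[of u] exp_not_eq_zero[of v]
        unfolding g_def by blast
      then show "u = v"
      proof (rule exp_complex_eqI[rotated])
        show "\<bar>Im u - Im v\<bar> < 2 * pi"
          using uv by (auto simp: in_box_complex_iff)
      qed
    qed
    have img: "\<psi> ` ?box \<subseteq> cball 0 (1 / \<rho> + K * \<rho>\<^sup>2)"
    proof safe
      fix u assume "u \<in> ?box"
      note u = ex[OF sub[OF this]]
      have "norm ((1 / exp u + b * exp u + (G (exp u) - b * exp u)) - b * of_real (\<rho>\<^sup>2) * cnj (1 / exp u + b * exp u + (G (exp u) - b * exp u))) \<le> 1 / \<rho> + K * \<rho>\<^sup>2"
        by (rule shear_bound[OF \<rho>(1) u(2) _ C(2)[OF u(1)] K_def small]) (use u r in linarith)
      then show "\<psi> u \<in> cball 0 (1 / \<rho> + K * \<rho>\<^sup>2)"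
        by (simp add: \<psi>_def g_def)
    qed
    have exC: "exp (Complex x y) = of_real (exp x) * cis y" for x y
      by (simp add: exp_eq_polar)
    let ?f = "\<lambda>x y. \<bar>(norm (p (Complex x y)))\<^sup>2 - (norm (q (Complex x y)))\<^sup>2\<bar>"
    have f: "?f x y = m * exp (- 2 * x) * (norm (F (of_real (exp x) * cis y)))\<^sup>2" for x y
    proof -
      have "(norm (q (Complex x y)))\<^sup>2 = (norm b)\<^sup>2 * \<rho> ^ 4 * (norm (p (Complex x y)))\<^sup>2"
        by (simp add: q_def norm_mult norm_power power_mult_distrib)
      then have "(norm (p (Complex x y)))\<^sup>2 - (norm (q (Complex x y)))\<^sup>2 = m * (norm (p (Complex x y)))\<^sup>2"
        by (simp add: m_def left_diff_distrib)
      then have f1: "?f x y = m * (norm (p (Complex x y)))\<^sup>2"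
        using m by (simp add: abs_mult)
      have "(norm (p (Complex x y)))\<^sup>2 = exp (- 2 * x) * (norm (F (of_real (exp x) * cis y)))\<^sup>2"
      proof -
        have e2: "exp (- 2 * x) = 1 / (exp x)\<^sup>2"
          by (simp add: exp_minus inverse_eq_divide flip: exp_double)
        have "norm (complex_of_real (exp x) * cis y) = exp x"
          by (simp add: norm_mult)
        then show ?thesis
          unfolding p_def exC e2 by (simp only: norm_divide power_divide times_divide_eq_left mult_1_left)
      qed
      then show ?thesis unfolding f1 by (simp only: mult.assoc)
    qed
    have up: "integral {?a..?d} (\<lambda>x. integral {0..2*pi} (?f x)) \<le> pi * (1 / \<rho> + K * \<rho>\<^sup>2)\<^sup>2"
      by (rule integral_jacobian_le_disc_area[OF cp cq d injb img]) (use \<rho> K in auto)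
    have lo: "m * pi * (1 / \<rho>\<^sup>2 - 1 / r\<^sup>2 + (\<Sum>n=1..N. n * (norm (fps_nth B n))\<^sup>2 * (r ^ (2 * n) - \<rho> ^ (2 * n)))) \<le>
        integral {?a..?d} (\<lambda>x. integral {0..2*pi} (?f x))"
    proof -
      let ?t = "\<lambda>k x. (norm (fps_nth A k))\<^sup>2 * exp ((2 * real k - 2) * x)"
      let ?T = "\<lambda>k x. if k = 1 then 0 else (norm (fps_nth A k))\<^sup>2 * (exp ((2 * real k - 2) * x) / (2 * real k - 2))"
      have le: "?a \<le> ?d" using \<rho> r by simp
      \<comment> \<open>For \<open>k = 1\<close> the exponent vanishes and an antiderivative would
        be linear in x, but the coefficient of \<open>A\<close> at 1 is 0. Hence no logarithm of
        \<open>r\<close> or \<open>\<rho>\<close> appears in the area.\<close>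
      have "(?t k has_integral ?T k ?d - ?T k ?a) {?a..?d}" for k
      proof (cases "k = 1")
        case True
        then show ?thesis using A(2) by simp
      next
        case False
        then have k: "2 * real k - 2 \<noteq> 0" by linarith
        show ?thesis
          by (rule fundamental_theorem_of_calculus[OF le])
             (use False k in \<open>auto intro!: derivative_eq_intros simp flip: has_real_derivative_iff_has_vector_derivative\<close>)
      qed
      then have "((\<lambda>x. m * (2 * pi * (\<Sum>k\<le>Suc N. ?t k x))) has_integral m * (2 * pi * (\<Sum>k\<le>Suc N. ?T k ?d - ?T k ?a))) {?a..?d}"
        by (intro has_integral_mult_right has_integral_sum) auto
      moreover have "((\<lambda>x. integral {0..2*pi} (?f x)) has_integral integral {?a..?d} (\<lambda>x. integral {0..2*pi} (?f x))) {?a..?d}"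
      proof (rule integrable_integral)
        have *: "continuous_on (cbox (?a, 0) (?d, 2*pi)) (\<lambda>z. Complex (fst z) (snd z))"
          by (simp add: Complex_eq) (intro continuous_intros)
        have sub: "(\<lambda>z. Complex (fst z) (snd z)) ` cbox (?a, 0) (?d, 2*pi) \<subseteq> ?cbox"
          by (auto simp: in_cbox_complex_iff cbox_Pair_eq)
        have "continuous_on (cbox (?a, 0) (?d, 2*pi)) (\<lambda>z. ?f (fst z) (snd z))"
          by (intro continuous_intros continuous_on_compose2[OF cp * sub] continuous_on_compose2[OF cq * sub])
        from integral_integrable_2dim[OF this]
        show "(\<lambda>x. integral {0..2*pi} (?f x)) integrable_on {?a..?d}" by simp
      qed
      ultimately have le: "m * (2 * pi * (\<Sum>k\<le>Suc N. ?T k ?d - ?T k ?a)) \<le> integral {?a..?d} (\<lambda>x. integral {0..2*pi} (?f x))"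
      proof (rule has_integral_le)
        fix x assume x: "x \<in> {?a..?d}"
        then have "exp x \<le> r" using r by (simp add: ln_ge_iff)
        then have x1: "exp x < 1" using r by linarith
        have "(\<Sum>k\<le>Suc N. ?t k x) = exp (- 2 * x) * (\<Sum>k\<le>Suc N. (norm (fps_nth A k))\<^sup>2 * exp x ^ (2 * k))"
          unfolding sum_distrib_left
          by (intro sum.cong refl) (simp add: algebra_simps flip: exp_of_nat_mult exp_add)
        then have "m * (2 * pi * (\<Sum>k\<le>Suc N. ?t k x)) = m * exp (- 2 * x) * (2 * pi * (\<Sum>k\<le>Suc N. (norm (fps_nth A k))\<^sup>2 * exp x ^ (2 * k)))"
          by simp
        also have "\<dots> \<le> m * exp (- 2 * x) * integral {0..2*pi} (\<lambda>y. (norm (F (of_real (exp x) * cis y)))\<^sup>2)"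
          using m by (intro mult_left_mono bessel_circle[OF F FA _ x1]) simp_all
        also have "\<dots> = integral {0..2*pi} (?f x)"
          unfolding f by simp
        finally show "m * (2 * pi * (\<Sum>k\<le>Suc N. ?t k x)) \<le> integral {0..2*pi} (?f x)" .
      qed
      \<comment> \<open>The term \<open>k = 0\<close> comes from the pole. For
        \<open>k = n + 1\<close> the squared coefficient carries \<open>n\<^sup>2\<close> and
        integration divides by \<open>2 * n\<close>, which leaves the weight n / 2.\<close>
      have eq: "2 * (\<Sum>k\<le>Suc N. ?T k ?d - ?T k ?a) = 1 / \<rho>\<^sup>2 - 1 / r\<^sup>2 + (\<Sum>n=1..N. n * (norm (fps_nth B n))\<^sup>2 * (r ^ (2 * n) - \<rho> ^ (2 * n)))"
      proof -
        have e: "exp (2 * real n * ln s) = s ^ (2 * n)" if "s > 0" for s n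
          using that exp_of_nat_mult[of "2 * n" "ln s"] by simp
        have e': "exp (- 2 * ln s) = 1 / s\<^sup>2" if "s > 0" for s :: real
          using exp_double[of "ln s"] that by (simp add: exp_minus inverse_eq_divide)
        have "(\<Sum>k\<le>Suc N. ?T k ?d - ?T k ?a) = (?T 0 ?d - ?T 0 ?a) + (\<Sum>n\<le>N. ?T (Suc n) ?d - ?T (Suc n) ?a)"
          by (rule sum.atMost_Suc_shift)
        also have "(\<Sum>n\<le>N. ?T (Suc n) ?d - ?T (Suc n) ?a) = (\<Sum>n=1..N. ?T (Suc n) ?d - ?T (Suc n) ?a)"
          by (rule sum.mono_neutral_right) (auto simp: not_le)
        also have "\<dots> = (\<Sum>n=1..N. (n * (norm (fps_nth B n))\<^sup>2 * (r ^ (2 * n) - \<rho> ^ (2 * n))) / 2)"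
        proof (rule sum.cong)
          fix n assume "n \<in> {1..N}"
          then show "?T (Suc n) ?d - ?T (Suc n) ?a = (n * (norm (fps_nth B n))\<^sup>2 * (r ^ (2 * n) - \<rho> ^ (2 * n))) / 2"
            using \<rho> r e by (simp add: A(3) norm_mult field_simps power2_eq_square)
        qed simp
        also have "?T 0 ?d - ?T 0 ?a = (1 / \<rho>\<^sup>2 - 1 / r\<^sup>2) / 2"
          using \<rho> r e' by (simp add: A(1) field_simps)
        finally show ?thesis by (simp add: sum_divide_distrib[symmetric])
      qed
      have "m * pi * (2 * S) = m * (2 * pi * S)" for S
        by simp
      with le show ?thesis
        unfolding eq[symmetric] by (simp only:)
    qed
    have "pi * (m * (1 / \<rho>\<^sup>2 - 1 / r\<^sup>2 + (\<Sum>n=1..N. n * (norm (fps_nth B n))\<^sup>2 * (r ^ (2 * n) - \<rho> ^ (2 * n))))) \<le> pi * (1 / \<rho> + K * \<rho>\<^sup>2)\<^sup>2"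
      using order.trans[OF lo up] by (simp only: mult_ac)
    then show ?thesis
      unfolding m_def by (subst (asm) mult_le_cancel_left_pos) auto
  qed
  show ?thesis
    by (rule that[OF \<epsilon> main[unfolded b_def]])
qed

text \<open>Subtracting \<open>G 0\<close> affects neither injectivity nor the coefficients from
  index 1 on, so \<open>area_annulus\<close> applies. The limit in \<open>\<rho>\<close> is taken
  first, for fixed \<open>r\<close>, because the constants \<open>K\<close> and
  \<open>\<epsilon>\<close> may depend on \<open>r\<close>; then \<open>r\<close> tends to
  1.\<close>

theorem area_theorem:
  assumes G: "G holomorphic_on ball 0 1" "G has_fps_expansion B"
    and inj: "inj_on (\<lambda>z. 1 / z + G z) (ball 0 1 - {0})"
  shows "(\<Sum>n=1..N. n * (norm (fps_nth B n))\<^sup>2) \<le> 1"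
proof -
  define S where "S x = (\<Sum>n=1..N. n * (norm (fps_nth B n))\<^sup>2 * x ^ (2 * n))" for x :: real
  define \<beta> where "\<beta> = norm (fps_nth B 1)"
  have contS: "isCont S x" for x
    unfolding S_def by (intro continuous_intros)
  have S0: "S 0 = 0"
    unfolding S_def by (intro sum.neutral) auto
  have r: "S r \<le> 1 / r\<^sup>2" if r: "0 < r" "r < 1" for r
  proof -
    define G' where "G' z = G z - G 0" for z
    define B' where "B' = B - fps_const (G 0)"
    have 1: "G' holomorphic_on ball 0 1" "G' has_fps_expansion B'" "G' 0 = 0"
      unfolding G'_def B'_def by (intro holomorphic_intros fps_expansion_intros G)+ auto
    have 2: "inj_on (\<lambda>z. 1 / z + G' z) (ball 0 1 - {0})"
      using inj by (simp add: inj_on_def G'_def)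
    obtain K \<epsilon> where \<epsilon>: "\<epsilon> > 0"
      and K: "\<And>\<rho>. 0 < \<rho> \<Longrightarrow> \<rho> < \<epsilon> \<Longrightarrow> \<rho> < r \<Longrightarrow> (1 - (norm (fps_nth B' 1))\<^sup>2 * \<rho> ^ 4) *
        (1 / \<rho>\<^sup>2 - 1 / r\<^sup>2 + (\<Sum>n=1..N. n * (norm (fps_nth B' n))\<^sup>2 * (r ^ (2 * n) - \<rho> ^ (2 * n)))) \<le> (1 / \<rho> + K * \<rho>\<^sup>2)\<^sup>2"
      by (rule area_annulus[OF 1 2 r, where N = N]) blast
    have B': "fps_nth B' n = fps_nth B n" if "n \<ge> 1" for n
      using that by (simp add: B'_def)
    have bound: "(1 - \<beta>\<^sup>2 * \<rho> ^ 4) * (S r - 1 / r\<^sup>2 - S \<rho>) \<le> \<beta>\<^sup>2 * \<rho>\<^sup>2 + 2 * K * \<rho> + K\<^sup>2 * \<rho> ^ 4"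
      if \<rho>: "0 < \<rho>" "\<rho> < \<epsilon>" "\<rho> < r" for \<rho>
    proof -
      have "(\<Sum>n=1..N. n * (norm (fps_nth B' n))\<^sup>2 * (r ^ (2 * n) - \<rho> ^ (2 * n))) = S r - S \<rho>"
        unfolding S_def sum_subtractf[symmetric] by (intro sum.cong) (auto simp: B' algebra_simps)
      with K[OF \<rho>] have "(1 - \<beta>\<^sup>2 * \<rho> ^ 4) * (1 / \<rho>\<^sup>2 - 1 / r\<^sup>2 + (S r - S \<rho>)) \<le> (1 / \<rho> + K * \<rho>\<^sup>2)\<^sup>2"
        by (simp only: B'[OF order.refl] \<beta>_def)
      \<comment> \<open>The divergent term \<open>1 / \<rho>\<^sup>2\<close> is split off here and
        in the square below. It cancels, and what remains has a limit as \<open>\<rho>\<close> tends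
        to 0.\<close>
      moreover have "(1 - \<beta>\<^sup>2 * \<rho> ^ 4) * (1 / \<rho>\<^sup>2 - 1 / r\<^sup>2 + (S r - S \<rho>)) =
          (1 - \<beta>\<^sup>2 * \<rho> ^ 4) * (S r - 1 / r\<^sup>2 - S \<rho>) + 1 / \<rho>\<^sup>2 - \<beta>\<^sup>2 * \<rho>\<^sup>2"
        using \<rho> by (simp add: algebra_simps power4_eq_xxxx power2_eq_square)
      moreover have "(1 / \<rho> + K * \<rho>\<^sup>2)\<^sup>2 = 1 / \<rho>\<^sup>2 + 2 * K * \<rho> + K\<^sup>2 * \<rho> ^ 4"
        using \<rho> by (simp add: field_simps power4_eq_xxxx power2_eq_square)
      ultimately show ?thesis by linarith
    qed
    have "((\<lambda>\<rho>. (1 - \<beta>\<^sup>2 * \<rho> ^ 4) * (S r - 1 / r\<^sup>2 - S \<rho>)) \<longlongrightarrow> (1 - \<beta>\<^sup>2 * 0 ^ 4) * (S r - 1 / r\<^sup>2 - S 0)) (at_right 0)"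
      using contS[of 0] unfolding isCont_def
      by (intro tendsto_intros filterlim_at_split[THEN iffD1, THEN conjunct2])
    moreover have "((\<lambda>\<rho>. \<beta>\<^sup>2 * \<rho>\<^sup>2 + 2 * K * \<rho> + K\<^sup>2 * \<rho> ^ 4) \<longlongrightarrow> \<beta>\<^sup>2 * 0\<^sup>2 + 2 * K * 0 + K\<^sup>2 * 0 ^ 4) (at_right 0)"
      by (intro tendsto_intros)
    moreover have "\<forall>\<^sub>F \<rho> in at_right 0. (1 - \<beta>\<^sup>2 * \<rho> ^ 4) * (S r - 1 / r\<^sup>2 - S \<rho>) \<le> \<beta>\<^sup>2 * \<rho>\<^sup>2 + 2 * K * \<rho> + K\<^sup>2 * \<rho> ^ 4"
      using eventually_at_right_less[of 0] eventually_at_right_real[of 0 "min \<epsilon> r"] \<epsilon> r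
      by (auto elim!: eventually_mono intro: bound)
    ultimately have "(1 - \<beta>\<^sup>2 * 0 ^ 4) * (S r - 1 / r\<^sup>2 - S 0) \<le> \<beta>\<^sup>2 * 0\<^sup>2 + 2 * K * 0 + K\<^sup>2 * 0 ^ 4"
      by (intro tendsto_le[OF trivial_limit_at_right_real])
    then show ?thesis by (simp add: S0)
  qed
  have "S 1 \<le> 1 / 1\<^sup>2"
  proof (rule tendsto_le[OF trivial_limit_at_left_real])
    show "((\<lambda>r. 1 / r\<^sup>2) \<longlongrightarrow> 1 / 1\<^sup>2) (at_left (1::real))"
      by (intro tendsto_intros) auto
    show "(S \<longlongrightarrow> S 1) (at_left 1)"
      using contS[of 1] unfolding isCont_def by (rule filterlim_at_split[THEN iffD1, THEN conjunct1])
    show "\<forall>\<^sub>F r in at_left 1. S r \<le> 1 / r\<^sup>2"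
      using eventually_at_left_real[of 0 "1::real"] by (auto elim!: eventually_mono intro: r)
  qed
  then show ?thesis by (simp add: S_def)
qed

subsection \<open>The third logarithmic coefficient\<close>

text \<open>Cauchy-Schwarz eliminates \<open>y\<close> and \<open>z\<close>, which leaves a
  comparison of squares in \<open>x\<close> alone. Equality at \<open>x = sqrt bound_root\<close>
  makes the difference touch 0, which explains the double root.\<close>

lemma gamma3_maximum:
  fixes x y z :: real
  assumes nonneg: "x \<ge> 0" and le: "x\<^sup>2 + 3 * y\<^sup>2 + 5 * z\<^sup>2 \<le> 1"
  shows "x ^ 3 / 3 + x * y + z \<le> gamma3_bound"
proof -
  define s where "s = sqrt bound_root"
  have s: "s > 0" "s\<^sup>2 = bound_root" using bound_root(1) by (auto simp: s_def)
  have root: "75 * s ^ 6 + 70 * s ^ 4 - 85 * s\<^sup>2 + 4 = 0"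
    using bound_root(3) by (simp add: s(2)[symmetric] flip: power_mult)
  define B where "B = gamma3_bound"
  have sB: "s * B = (5 * s ^ 4 + 10 * s\<^sup>2 - 2) / 15"
    using s(1) unfolding B_def gamma3_bound_def s_def[symmetric] s(2)[symmetric]
    by (simp flip: power_mult)
  \<comment> \<open>The cubic equation for \<open>bound_root\<close> enters here: after
    multiplication by \<open>s\<^sup>2\<close> the two sides differ by a multiple of it.\<close>
  have BB: "B\<^sup>2 = 1 / 5 + s ^ 6 / 9 + s ^ 4 / 9 + 2 * s\<^sup>2 / 45"
  proof -
    have "(s * B)\<^sup>2 - s\<^sup>2 * (1 / 5 + s ^ 6 / 9 + s ^ 4 / 9 + 2 * s\<^sup>2 / 45) =
        (75 * s ^ 6 + 70 * s ^ 4 - 85 * s\<^sup>2 + 4) / 225"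
      unfolding sB by (simp add: field_simps eval_nat_numeral)
    then have "s\<^sup>2 * B\<^sup>2 = s\<^sup>2 * (1 / 5 + s ^ 6 / 9 + s ^ 4 / 9 + 2 * s\<^sup>2 / 45)"
      by (simp add: root power_mult_distrib)
    then show ?thesis using s(1) by simp
  qed
  \<comment> \<open>Cauchy-Schwarz for \<open>x y + z\<close> leaves a polynomial inequality in \<open>x\<close>; the polynomial has the double
    root \<open>s\<close>, and \<open>q\<close> is the quotient.\<close>
  define c where "c = 2 * s / 3 + 4 * s ^ 3 / 9 - 2 * B / 3"
  define q where "q = x ^ 4 / 9 + 2 * s / 9 * x ^ 3 + (1 + s\<^sup>2) / 3 * x\<^sup>2 + c * x + s * c / 2"
  \<comment> \<open>This holds identically in \<open>B\<close>, \<open>s\<close> and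
    \<open>x\<close>; both brackets on the right vanish by \<open>BB\<close> and
    \<open>sB\<close>.\<close>
  have "(B - x ^ 3 / 3)\<^sup>2 - (1 - x\<^sup>2) * (x\<^sup>2 / 3 + 1 / 5) - (x - s)\<^sup>2 * q =
      (B\<^sup>2 - (1 / 5 + s ^ 6 / 9 + s ^ 4 / 9 + 2 * s\<^sup>2 / 45)) -
      (x\<^sup>2 - s\<^sup>2 / 3) * (s * B - (5 * s ^ 4 + 10 * s\<^sup>2 - 2) / 15)"
    unfolding q_def c_def by (simp add: field_simps eval_nat_numeral)
  then have id: "(B - x ^ 3 / 3)\<^sup>2 - (1 - x\<^sup>2) * (x\<^sup>2 / 3 + 1 / 5) = (x - s)\<^sup>2 * q"
    unfolding sB BB by simp
  \<comment> \<open>Only \<open>c\<close> contains a negative summand, and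
    \<open>2 * s / 3 \<ge> 8 / 15\<close> exceeds \<open>2 * B / 3 < 2 / 5\<close>.\<close>
  have "4 / 5 \<le> s"
    by (rule power2_le_imp_le) (use s bound_root(1) in \<open>simp_all add: power2_eq_square\<close>)
  moreover have "0 \<le> s ^ 3" using s(1) by simp
  moreover have "B < 3 / 5" using gamma3_bound_digits(2) by (simp add: B_def)
  ultimately have "0 \<le> c"
    unfolding c_def by linarith
  then have q0: "q \<ge> 0"
    unfolding q_def using s(1) nonneg by (intro add_nonneg_nonneg mult_nonneg_nonneg) auto
  have CS: "(x * y + z)\<^sup>2 \<le> (1 - x\<^sup>2) * (x\<^sup>2 / 3 + 1 / 5)"
  proof -
    \<comment> \<open>Lagrange's identity for the vectors (sqrt 3 y, sqrt 5 z) and (x / sqrt 3, 1 /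
      sqrt 5).\<close>
    have "(x * y + z)\<^sup>2 + (x * z * 5 / 3 - y)\<^sup>2 * (3 / 5) = (3 * y\<^sup>2 + 5 * z\<^sup>2) * (x\<^sup>2 / 3 + 1 / 5)"
      by (simp add: power2_eq_square algebra_simps)
    moreover have "0 \<le> (x * z * 5 / 3 - y)\<^sup>2 * (3 / 5)" by simp
    moreover have "(3 * y\<^sup>2 + 5 * z\<^sup>2) * (x\<^sup>2 / 3 + 1 / 5) \<le> (1 - x\<^sup>2) * (x\<^sup>2 / 3 + 1 / 5)"
      using le by (intro mult_right_mono) auto
    ultimately show ?thesis by linarith
  qed
  \<comment> \<open>The bound \<open>x \<le> 1\<close> makes \<open>B - x ^ 3 / 3\<close>
    nonnegative, so that the comparison of squares can be undone.\<close>
  have "x\<^sup>2 \<le> 1\<^sup>2" using le zero_le_power2[of y] zero_le_power2[of z] unfolding one_power2 by linarith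
  then have "x \<le> 1" by (rule power2_le_imp_le) simp
  then have "x ^ 3 \<le> 1" using nonneg by (intro power_le_one) auto
  then have pos: "0 \<le> B - x ^ 3 / 3" unfolding B_def using gamma3_bound_digits(1) by simp
  have "0 \<le> (x - s)\<^sup>2 * q" using q0 by simp
  then have "(x * y + z)\<^sup>2 \<le> (B - x ^ 3 / 3)\<^sup>2" using CS id by linarith
  then have "x * y + z \<le> B - x ^ 3 / 3" using pos by (rule power2_le_imp_le)
  then show ?thesis by (simp add: B_def)
qed

text \<open>The coefficients of \<open>B\<close> at 1, 3, 5 are the negatives of a, b, c in the
  overview. They are the first three coefficients of exp (- F / 2) after the constant term, because
  1 / z + G z = E (z^2) / z.\<close>

lemma log_coeff_3_area_coeffs:
  assumes f: "f \<in> \<S>"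
  obtains G B where "G holomorphic_on \<D>" "G has_fps_expansion B" 
    "inj_on (\<lambda>z. 1 / z + G z) (\<D> - {0})"
    "\<gamma> f 3 = - (fps_nth B 1 ^ 3 / 3) + fps_nth B 1 * fps_nth B 3 - fps_nth B 5"
proof -
  define F where "F = log_branch f"
  have F: "F holomorphic_on \<D>" "F 0 = 0" "\<And>z. z \<in> \<D> \<Longrightarrow> exp (F z) = (if z = 0 then 1 else f z / z)"
    using log_branch[OF f] by (auto simp: F_def is_log_branch_def)
  have injf: "inj_on f \<D>"
    using f by (simp add: class_S_def)
  define \<Phi> where "\<Phi> = fps_expansion F 0"
  have \<Phi>: "F has_fps_expansion \<Phi>"
    unfolding \<Phi>_def using F(1) by (intro has_fps_expansion_fps_expansion[of \<D>]) auto
  have \<gamma>: "\<gamma> f n = fps_nth \<Phi> n / 2" for n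
    by (simp add: log_coeff_def \<Phi>_def F_def)
  define E where "E t = exp (- F t / 2)" for t
  have E: "E holomorphic_on \<D>" "E 0 = 1" "\<And>t. E t \<noteq> 0"
    using F unfolding E_def by (auto intro!: holomorphic_intros)
  define e where "e = fps_expansion E 0"
  have e: "E has_fps_expansion e"
    unfolding e_def using E(1) by (intro has_fps_expansion_fps_expansion[of \<D>]) auto
  have e0: "fps_nth e 0 = 1"
    using E(2) by (simp add: e_def fps_expansion_def)
  \<comment> \<open>The differential equation E' = - F' E / 2 in power series form. Its coefficients
    at 0, 1, 2 express those of \<open>e\<close> through the logarithmic coefficients.\<close>
  have de: "fps_deriv e = fps_const (- 1 / 2) * fps_deriv \<Phi> * e"
  proof -
    have "(\<lambda>t. - 1 / 2 * deriv F t * E t) has_fps_expansion fps_const (- 1 / 2) * fps_deriv \<Phi> * e"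
      by (intro fps_expansion_intros \<Phi> e)
    moreover have "deriv E has_fps_expansion fps_deriv e"
      by (intro fps_expansion_intros e)
    moreover have "\<forall>\<^sub>F t in nhds 0. deriv E t = - 1 / 2 * deriv F t * E t"
    proof -
      have "\<forall>\<^sub>F t in nhds 0. t \<in> \<D>"
        by (intro eventually_nhds_in_open) auto
      then show ?thesis
      proof eventually_elim
        case (elim t)
        have "(F has_field_derivative deriv F t) (at t)"
          by (rule holomorphic_derivI[OF F(1) open_ball elim])
        then have "(E has_field_derivative - 1 / 2 * deriv F t * E t) (at t)"
          unfolding E_def by (auto intro!: derivative_eq_intros)
        then show ?case by (rule DERIV_imp_deriv)
      qed
    qed
    ultimately show ?thesis
      using has_fps_expansion_cong fps_expansion_unique_complex by metis
  qed
  have e1: "fps_nth e 1 = - \<gamma> f 1"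
    using arg_cong[OF de, of "\<lambda>X. fps_nth X 0"] by (simp add: e0 \<gamma>)
  have e2: "2 * fps_nth e 2 = - (\<gamma> f 1 * fps_nth e 1 + 2 * \<gamma> f 2)"
    using arg_cong[OF de, of "\<lambda>X. fps_nth X 1"]
    by (simp add: fps_mult_nth e0 \<gamma> numeral_2_eq_2 field_simps)
  have e3: "3 * fps_nth e 3 = - (\<gamma> f 1 * fps_nth e 2 + 2 * \<gamma> f 2 * fps_nth e 1 + 3 * \<gamma> f 3)"
    using arg_cong[OF de, of "\<lambda>X. fps_nth X 2"]
    by (simp add: fps_mult_nth e0 \<gamma> numeral_2_eq_2 numeral_3_eq_3 field_simps) algebra
  define h where "h z = E (z\<^sup>2)" for z
  have sq: "z\<^sup>2 \<in> \<D>" if "z \<in> \<D>" for z :: complex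
    using that by (simp add: norm_power power_less_one_iff)
  have h: "h holomorphic_on \<D>"
    unfolding h_def
    by (intro holomorphic_on_compose_gen[OF _ E(1), unfolded o_def] holomorphic_intros) (use sq in auto)
  define G where "G z = (if z = 0 then deriv h 0 else (h z - h 0) / (z - 0))" for z
  have G: "G holomorphic_on \<D>"
    unfolding G_def by (rule pole_lemma_open[OF h]) auto
  define B where "B = fps_expansion G 0"
  have B: "G has_fps_expansion B"
    unfolding B_def using G by (intro has_fps_expansion_fps_expansion[of \<D>]) auto
  have hG: "h z = z * G z + 1" for z
    by (simp add: G_def h_def E(2))
  \<comment> \<open>Two expansions of E (z^2); comparing even powers gives the index
    \<open>2 * n - 1\<close> in \<open>Bn\<close>.\<close>
  have eB: "fps_X * B + 1 = e oo fps_X ^ 2"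
  proof (rule fps_expansion_unique_complex)
    show "h has_fps_expansion fps_X * B + 1"
      unfolding hG by (intro fps_expansion_intros B)
    have "(E \<circ> (\<lambda>z. z ^ 2)) has_fps_expansion (e oo fps_X ^ 2)"
      by (intro has_fps_expansion_compose e fps_expansion_intros) auto
    then show "h has_fps_expansion (e oo fps_X ^ 2)"
      by (simp add: h_def[abs_def] o_def)
  qed
  have Bn: "fps_nth B (2 * n - 1) = fps_nth e n" if "n > 0" for n
  proof -
    have "fps_nth (fps_X * B + 1) (2 * n) = fps_nth B (2 * n - 1)"
      using that by simp
    moreover have "fps_nth (e oo fps_X ^ 2) (2 * n) = fps_nth e n"
    proof -
      have "fps_nth (e oo fps_X ^ 2) (2 * n) = (\<Sum>i=0..2 * n. if i = n then fps_nth e i else 0)"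
        unfolding fps_compose_nth power_mult[symmetric] by (intro sum.cong) auto
      then show ?thesis by simp
    qed
    ultimately show ?thesis by (simp add: eB)
  qed
  have inj: "inj_on (\<lambda>z. 1 / z + G z) (\<D> - {0})"
  proof (rule inj_onI)
    fix z w assume zw: "z \<in> \<D> - {0}" "w \<in> \<D> - {0}" "1 / z + G z = 1 / w + G w"
    have g: "1 / z + G z = E (z\<^sup>2) / z" if "z \<noteq> 0" for z
      using that by (simp add: G_def h_def E(2) field_simps)
    \<comment> \<open>The square recovers 1 / f (z^2), so univalence of \<open>f\<close> leaves
      \<open>z = w\<close> or \<open>z = - w\<close>. The second case fails because E (z^2) / z is
      odd and \<open>E\<close> has no zeros.\<close>
    have Ef: "(E (z\<^sup>2) / z)\<^sup>2 = 1 / f (z\<^sup>2)" if "z \<in> \<D> - {0}" for z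
    proof -
      have "(E (z\<^sup>2))\<^sup>2 = inverse (exp (F (z\<^sup>2)))"
        by (simp add: E_def flip: exp_double exp_minus)
      also have "exp (F (z\<^sup>2)) = f (z\<^sup>2) / z\<^sup>2"
        using F(3)[OF sq[of z]] that by auto
      finally show ?thesis using that by (simp add: power_divide)
    qed
    have eq: "E (z\<^sup>2) / z = E (w\<^sup>2) / w"
      using zw g by auto
    then have "1 / f (z\<^sup>2) = 1 / f (w\<^sup>2)"
      using Ef[OF zw(1)] Ef[OF zw(2)] by simp
    then have "f (z\<^sup>2) = f (w\<^sup>2)" by simp
    then have zw2: "z\<^sup>2 = w\<^sup>2"
      by (rule inj_onD[OF injf _ sq sq]) (use zw in simp_all)
    then have "z = w \<or> z = - w" by (simp add: power2_eq_iff)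
    moreover have "z \<noteq> - w"
    proof
      assume "z = - w"
      then show False using eq zw2 E(3)[of "w\<^sup>2"] zw by (simp add: field_simps)
    qed
    ultimately show "z = w" by blast
  qed
  have B135: "fps_nth B 1 = fps_nth e 1" "fps_nth B 3 = fps_nth e 2" "fps_nth B 5 = fps_nth e 3"
    using Bn[of 1] Bn[of 2] Bn[of 3] by simp_all
  have "\<gamma> f 3 = - (fps_nth B 1 ^ 3 / 3) + fps_nth B 1 * fps_nth B 3 - fps_nth B 5"
  proof -
    have g1: "\<gamma> f 1 = - fps_nth e 1" using e1 by simp
    have g2: "2 * \<gamma> f 2 = (fps_nth e 1)\<^sup>2 - 2 * fps_nth e 2"
      using e2 unfolding g1 by (simp add: power2_eq_square algebra_simps)
    have "3 * \<gamma> f 3 = - (\<gamma> f 1 * fps_nth e 2 + 2 * \<gamma> f 2 * fps_nth e 1) - 3 * fps_nth e 3"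
      unfolding e3 by simp
    also have "\<dots> = - (fps_nth e 1 ^ 3) + 3 * (fps_nth e 1 * fps_nth e 2) - 3 * fps_nth e 3"
      unfolding g1 g2 by (simp add: power2_eq_square power3_eq_cube algebra_simps)
    finally show ?thesis
      unfolding B135 by (simp add: field_simps)
  qed
  with G B inj show ?thesis by (rule that)
qed

theorem theorem2:
  fixes f :: "complex \<Rightarrow> complex"
  assumes "f \<in> \<S>"
  shows "norm (\<gamma> f 3) \<le> gamma3_bound"
proof -
  obtain G B where G: "G holomorphic_on \<D>" "G has_fps_expansion B" "inj_on (\<lambda>z. 1 / z + G z) (\<D> - {0})"
    and \<gamma>3: "\<gamma> f 3 = - (fps_nth B 1 ^ 3 / 3) + fps_nth B 1 * fps_nth B 3 - fps_nth B 5"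
    using log_coeff_3_area_coeffs[OF assms] by blast
  have *: "(norm (fps_nth B 1))\<^sup>2 + 3 * (norm (fps_nth B 3))\<^sup>2 + 5 * (norm (fps_nth B 5))\<^sup>2 \<le> 1"
  proof -
    \<comment> \<open>The remaining terms of the area sum are nonnegative and are dropped.\<close>
    have "(\<Sum>n\<in>{1,3,5}. n * (norm (fps_nth B n))\<^sup>2) \<le> (\<Sum>n=1..5. n * (norm (fps_nth B n))\<^sup>2)"
      by (intro sum_mono2) auto
    also have "\<dots> \<le> 1" by (rule area_theorem[OF G])
    finally show ?thesis by simp
  qed
  have "norm (\<gamma> f 3) \<le> norm (fps_nth B 1 ^ 3 / 3) + norm (fps_nth B 1 * fps_nth B 3) + norm (fps_nth B 5)"
    unfolding \<gamma>3
    by (intro order.trans[OF norm_triangle_ineq4] order.trans[OF norm_triangle_ineq] add_mono) auto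
  also have "\<dots> = norm (fps_nth B 1) ^ 3 / 3 + norm (fps_nth B 1) * norm (fps_nth B 3) + norm (fps_nth B 5)"
    by (simp add: norm_divide norm_power norm_mult)
  also have "\<dots> \<le> gamma3_bound"
    by (rule gamma3_maximum[OF norm_ge_zero *])
  finally show ?thesis .
qed

end
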